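(* For every query $Q$, the output of the max-degree-with-reshaping algorithm on input $Q$ (for any choices made by the algorithm) is a decomposition of $Q$ that includes only subject-object star queries.
   Context: Fix countably infinite, pairwise disjoint sets $U_{so}$ and $U_p$ (URIs), $L$ (literals) and $\mathrm{Var}$ (variables). A query is a finite non-empty set of triples in $(U_{so}\cup \mathrm{Var})\times U_p\times (U_{so}\cup L\cup \mathrm{Var})$. In a triple $(s,p,o)$, $s$ is the subject and $o$ the object; $\mathcal{N}(Q)$ is the set of all subjects and objects of triples of $Q$. A decomposition of $Q$ is a finite family of non-empty subsets (subqueries) of $Q$ whose union is $Q$. A subject-object star query (so-query) with central node $c$ is a query such that every triple has $c$ as subject or object and at least one triple has $c$ as subject; a query is an so-query if this holds for some $c$. The max-degree-with-reshaping algorithm on input $Q$. Initialize $R=\emptyset$, $C=\emptyset$ (covered triples), and let $S_Q$ be the set of all pairs $(n,S(n))$ where $n\in\mathcal{N}(Q)\setminus L$ is the subject of at least one triple of $Q$ and $S(n)$ is the set of all triples of $Q$ having $n$ as subject or object. While $S_Q\neq\emptyset$, do the following. - Select a pair $(n,Q')\in S_Q$ maximizing the number $|Q'\setminus C|$ of not covered triples (ties arbitrary). - Let $S'=Q'\setminus\{(s,p,n)\in Q' \cap C\mid s\text{ is a variable}\}$ and $T=\{(n,p,o)\in Q'\cap C\mid o\text{ is a variable}\}$. - If $S'\setminus T$ is an so-query with central node $n$, let $S=S'\setminus T$. Otherwise choose a triple $t'\in T$, let $S=(S'\setminus T)\cup\{t'\}$, and replace $F$ by $F\setminus\{t'\}$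 in $R$, where $F$ is the query in $R$ containing $t'$. - Add $S$ to $R$; replace $C$ by $C\cup S$; delete $(n,Q')$ from $S_Q$; then delete from $S_Q$ every pair $(m,P)$ with $P\subseteq C$ (the other pairs are kept unchanged). Return $R$. *)

theory Defs
  imports Main "HOL-Library.Countable_Set"
begin

record 'a vocabulary =
  so_uris :: "'a set"
  pred_uris :: "'a set"
  literals :: "'a set"
  variables :: "'a set"

definition vocabulary_ok :: "'a vocabulary \<Rightarrow> bool" where
  "vocabulary_ok V \<longleftrightarrow>
     (countable (so_uris V) \<and> infinite (so_uris V)) \<and>
     (countable (pred_uris V) \<and> infinite (pred_uris V)) \<and>
     (countable (literals V) \<and> infinite (literals V)) \<and>
     (countable (variables V) \<and> infinite (variables V)) \<and>
     so_uris V \<inter> pred_uris V = {} \<and> so_uris V \<inter> literals V = {} \<and>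
     so_uris V \<inter> variables V = {} \<and> pred_uris V \<inter> literals V = {} \<and>
     pred_uris V \<inter> variables V = {} \<and> literals V \<inter> variables V = {}"

type_synonym 'a triple = "'a \<times> 'a \<times> 'a"

definition subj :: "'a triple \<Rightarrow> 'a" where
  "subj t = fst t"

definition obj :: "'a triple \<Rightarrow> 'a" where
  "obj t = snd (snd t)"

definition is_query :: "'a vocabulary \<Rightarrow> 'a triple set \<Rightarrow> bool" where
  "is_query V Q \<longleftrightarrow> finite Q \<and> Q \<noteq> {} \<and>
     Q \<subseteq> (so_uris V \<union> variables V) \<times> pred_uris V \<times> (so_uris V \<union> literals V \<union> variables V)"

definition nodes :: "'a triple set \<Rightarrow> 'a set" where
  "nodes Q = subj ` Q \<union> obj ` Q"

definition is_decomposition :: "'a triple set \<Rightarrow> 'a triple set set \<Rightarrow> bool" where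
  "is_decomposition Q R \<longleftrightarrow> finite R \<and> (\<forall>F\<in>R. F \<noteq> {} \<and> F \<subseteq> Q) \<and> \<Union>R = Q"

definition so_query_center :: "'a vocabulary \<Rightarrow> 'a \<Rightarrow> 'a triple set \<Rightarrow> bool" where
  "so_query_center V c Q \<longleftrightarrow> is_query V Q \<and>
     (\<forall>t\<in>Q. subj t = c \<or> obj t = c) \<and> (\<exists>t\<in>Q. subj t = c)"

definition so_query :: "'a vocabulary \<Rightarrow> 'a triple set \<Rightarrow> bool" where
  "so_query V Q \<longleftrightarrow> (\<exists>c. so_query_center V c Q)"

definition star :: "'a triple set \<Rightarrow> 'a \<Rightarrow> 'a triple set" where
  "star Q n = {t \<in> Q. subj t = n \<or> obj t = n}"

text \<open>A state of the loop consists of the queries built so far (\<open>R\<close>), the covered triples (\<open>C\<close>)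
  and the pairs still to be processed (\<open>P\<close>, the set \<open>S_Q\<close> of the pseudocode).\<close>

type_synonym 'a mdr_state = "'a triple set set \<times> 'a triple set \<times> ('a \<times> 'a triple set) set"

definition mdr_init :: "'a vocabulary \<Rightarrow> 'a triple set \<Rightarrow> 'a mdr_state" where
  "mdr_init V Q = ({}, {}, {(n, star Q n) | n. n \<in> nodes Q - literals V \<and> (\<exists>t\<in>Q. subj t = n)})"

definition max_uncovered ::
    "'a triple set \<Rightarrow> ('a \<times> 'a triple set) set \<Rightarrow> 'a \<Rightarrow> 'a triple set \<Rightarrow> bool" where
  "max_uncovered C P n Q' \<longleftrightarrow> (n, Q') \<in> P \<and> (\<forall>(m, M)\<in>P. card (M - C) \<le> card (Q' - C))"

definition inner_part ::
    "'a vocabulary \<Rightarrow> 'a triple set \<Rightarrow> 'a \<Rightarrow> 'a triple set \<Rightarrow> 'a triple set" where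
  "inner_part V C n Q' = Q' - {t \<in> Q' \<inter> C. obj t = n \<and> subj t \<in> variables V}"

definition removable_part ::
    "'a vocabulary \<Rightarrow> 'a triple set \<Rightarrow> 'a \<Rightarrow> 'a triple set \<Rightarrow> 'a triple set" where
  "removable_part V C n Q' = {t \<in> Q' \<inter> C. subj t = n \<and> obj t \<in> variables V}"

definition remaining ::
    "'a triple set \<Rightarrow> ('a \<times> 'a triple set) set \<Rightarrow> 'a \<times> 'a triple set \<Rightarrow> ('a \<times> 'a triple set) set" where
  "remaining C P x = {(m, M) \<in> P - {x}. \<not> M \<subseteq> C}"

text \<open>One iteration of the loop. The relation leaves open the selected pair, \<open>t'\<close>, and also
  which query \<open>F\<close> containing \<open>t'\<close> is reduced, so it does not presuppose that \<open>F\<close> is unique.\<close>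

inductive mdr_step :: "'a vocabulary \<Rightarrow> 'a mdr_state \<Rightarrow> 'a mdr_state \<Rightarrow> bool"
  for V :: "'a vocabulary" where
  plain:
    "\<lbrakk> max_uncovered C P n Q';
       S' = inner_part V C n Q'; T = removable_part V C n Q';
       so_query_center V n (S' - T);
       S = S' - T \<rbrakk>
     \<Longrightarrow> mdr_step V (R, C, P) (insert S R, C \<union> S, remaining (C \<union> S) P (n, Q'))"
| reshape:
    "\<lbrakk> max_uncovered C P n Q';
       S' = inner_part V C n Q'; T = removable_part V C n Q';
       \<not> so_query_center V n (S' - T);
       t' \<in> T; F \<in> R; t' \<in> F;
       S = (S' - T) \<union> {t'} \<rbrakk>
     \<Longrightarrow> mdr_step V (R, C, P)
           (insert S (insert (F - {t'}) (R - {F})), C \<union> S, remaining (C \<union> S) P (n, Q'))"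

definition mdr_output :: "'a vocabulary \<Rightarrow> 'a triple set \<Rightarrow> 'a triple set set \<Rightarrow> bool" where
  "mdr_output V Q R \<longleftrightarrow> (\<exists>C. (mdr_step V)\<^sup>*\<^sup>* (mdr_init V Q) (R, C, {}))"

text \<open>Whatever choices are made, the algorithm returns: no run is infinite, and no run gets stuck
  with pairs left to process (for lack of a suitable \<open>t'\<close> or \<open>F\<close>).\<close>

definition mdr_always_returns :: "'a vocabulary \<Rightarrow> 'a triple set \<Rightarrow> bool" where
  "mdr_always_returns V Q \<longleftrightarrow> termip (mdr_step V) (mdr_init V Q) \<and>
     (\<forall>R C P. (mdr_step V)\<^sup>*\<^sup>* (mdr_init V Q) (R, C, P) \<and> P \<noteq> {} \<longrightarrow>
        (\<exists>\<sigma>. mdr_step V (R, C, P) \<sigma>))"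

end

theory Submission
  imports Defs
begin

text \<open>Each query of \<open>R\<close> is a star query with a center that is no longer pending. If
  \<open>t'\<close> has the pending subject \<open>n\<close> and lies in a query \<open>F\<close> of \<open>R\<close>, then the center of
  \<open>F\<close> must be the object of \<open>t'\<close> and differs from \<open>n\<close>. Hence \<open>t'\<close> is not the triple
  of \<open>F\<close> that has the center as subject, and \<open>F - {t'}\<close> is still a star query with the same
  center. The same argument shows that a loop at a pending node is never covered, so that a suitable
  \<open>t'\<close> exists whenever the reshaping case arises. The greedy choice of the pair plays no role.\<close>

lemma is_query_subset:
  assumes "is_query V Q" "S \<subseteq> Q" "S \<noteq> {}"
  shows "is_query V S"
  using assms finite_subset[of S Q] subset_trans[of S Q] unfolding is_query_def by meson

text \<open>The star already forces every triple to touch \<open>c\<close>, so one triple with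
  subject \<open>c\<close> is all that is missing. Read contrapositively: a part of the star that
  fails to be a star query centered at \<open>c\<close> has no triple with subject
  \<open>c\<close>.\<close>

lemma so_query_center_subset_star:
  assumes "is_query V Q" "S \<subseteq> star Q c" "t \<in> S" "subj t = c"
  shows "so_query_center V c S"
proof -
  have "is_query V S"
    by (rule is_query_subset[OF assms(1)]) (use assms(2,3) in \<open>auto simp: star_def\<close>)
  then show ?thesis using assms(2-4) by (auto simp: so_query_center_def star_def)
qed

lemma so_query_center_Diff_incoming:
  assumes "so_query_center V c F" "subj t \<noteq> c"
  shows "so_query_center V c (F - {t})"
proof -
  obtain u where u: "u \<in> F - {t}" "subj u = c"
    using assms unfolding so_query_center_def by blast
  have "is_query V (F - {t})"
    by (rule is_query_subset[of V F]) (use assms(1) u(1) in \<open>auto simp: so_query_center_def\<close>)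
  then show ?thesis using assms(1) u by (auto simp: so_query_center_def)
qed

lemma remaining_subset: "remaining C P x \<subseteq> P - {x}"
  unfolding remaining_def by auto

text \<open>Each node is paired only with its own star, so deleting one pair removes its node from
  the pending nodes altogether.\<close>

lemma fst_in_remaining:
  assumes "n \<in> fst ` remaining C P (m, star Q m)"
    and "\<And>n M. (n, M) \<in> P \<Longrightarrow> M = star Q n"
  shows "n \<in> fst ` P \<and> n \<noteq> m"
proof -
  obtain M where M: "(n, M) \<in> remaining C P (m, star Q m)" using assms(1) by force
  then have "(n, M) \<in> P" "(n, M) \<noteq> (m, star Q m)" by (auto simp: remaining_def)
  moreover have "M = star Q n" using assms(2) \<open>(n, M) \<in> P\<close> .
  ultimately show ?thesis by force
qed

lemma ex_max_uncovered:
  assumes "finite P" "P \<noteq> {}"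
  shows "\<exists>n Q'. max_uncovered C P n Q'"
proof -
  let ?f = "\<lambda>x. card (snd x - C)"
  have "Max (?f ` P) \<in> ?f ` P" using assms by simp
  then obtain x where "x \<in> P" "?f x = Max (?f ` P)" by fastforce
  moreover have "?f y \<le> Max (?f ` P)" if "y \<in> P" for y using assms that by simp
  ultimately have "max_uncovered C P (fst x) (snd x)"
    unfolding max_uncovered_def by fastforce
  then show ?thesis by blast
qed

text \<open>The conjunct on centers makes reshaping safe, the one on pending pairs yields a
  candidate for \<open>t'\<close>, and the last one forces \<open>C = Q\<close> once nothing is
  pending.\<close>

definition mdr_invariant :: "'a vocabulary \<Rightarrow> 'a triple set \<Rightarrow> 'a mdr_state \<Rightarrow> bool" where
  "mdr_invariant V Q = (\<lambda>(R, C, P). finite R \<and> finite P \<and> \<Union>R = C \<and> C \<subseteq> Q \<and>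
     (\<forall>F\<in>R. \<exists>c. so_query_center V c F \<and> c \<notin> fst ` P) \<and>
     (\<forall>(n, M)\<in>P. M = star Q n \<and> (\<exists>t\<in>Q. subj t = n)) \<and>
     (\<forall>t\<in>Q - C. subj t \<in> fst ` P))"

lemma mdr_invariantD:
  assumes "mdr_invariant V Q (R, C, P)"
  shows "finite R" "finite P" "\<Union>R = C" "C \<subseteq> Q"
    and "\<And>F. F \<in> R \<Longrightarrow> \<exists>c. so_query_center V c F \<and> c \<notin> fst ` P"
    and "\<And>n M. (n, M) \<in> P \<Longrightarrow> M = star Q n"
    and "\<And>n M. (n, M) \<in> P \<Longrightarrow> \<exists>t\<in>Q. subj t = n"
    and "\<And>t. t \<in> Q \<Longrightarrow> t \<notin> C \<Longrightarrow> subj t \<in> fst ` P"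
  using assms unfolding mdr_invariant_def by auto

lemma mdr_invariant_init:
  assumes "vocabulary_ok V" "is_query V Q"
  shows "mdr_invariant V Q (mdr_init V Q)"
proof -
  let ?P = "{(n, star Q n) | n. n \<in> nodes Q - literals V \<and> (\<exists>t\<in>Q. subj t = n)}"
  have "finite (nodes Q)" using assms(2) by (simp add: is_query_def nodes_def)
  then have "finite ((\<lambda>n. (n, star Q n)) ` nodes Q)" by simp
  then have fin: "finite ?P" by (rule finite_subset[rotated]) auto
  have "subj t \<in> fst ` ?P" if t: "t \<in> Q" for t
  proof -
    have "subj t \<in> so_uris V \<union> variables V"
      using assms(2) t unfolding is_query_def subj_def by force
    \<comment> \<open>By disjointness of the vocabulary, excluding literals from the initial pairs
      loses no subject.\<close>
    then have "subj t \<notin> literals V"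
      using assms(1) unfolding vocabulary_ok_def by blast
    moreover have "subj t \<in> nodes Q" using t by (simp add: nodes_def)
    ultimately have "(subj t, star Q (subj t)) \<in> ?P" using t by blast
    then show ?thesis by force
  qed
  with fin show ?thesis by (auto simp: mdr_init_def mdr_invariant_def)
qed

text \<open>The part common to both kinds of iteration. \<open>R'\<close> is abstract so that it may
  contain a reduced query; the center \<open>n\<close> of \<open>S\<close> stops being pending
  exactly in this step.\<close>

lemma mdr_invariant_select:
  assumes inv: "mdr_invariant V Q (R, C, P)" and n: "(n, star Q n) \<in> P"
    and R': "finite R'" "\<Union>R' = C \<union> S"
      "\<And>F. F \<in> R' \<Longrightarrow> F = S \<or> (\<exists>c. so_query_center V c F \<and> c \<notin> fst ` P)"
    and S: "so_query_center V n S" "S \<subseteq> star Q n" "star Q n \<subseteq> C \<union> S"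
  shows "mdr_invariant V Q (R', C \<union> S, remaining (C \<union> S) P (n, star Q n))"
proof -
  note D = mdr_invariantD[OF inv]
  let ?P = "remaining (C \<union> S) P (n, star Q n)"
  have sub: "?P \<subseteq> P" using remaining_subset[of "C \<union> S" P "(n, star Q n)"] by auto
  have "\<exists>c. so_query_center V c F \<and> c \<notin> fst ` ?P" if "F \<in> R'" for F
    using R'(3)[OF that] S(1) sub fst_in_remaining[OF _ D(6)] by blast
  moreover have "subj t \<in> fst ` ?P" if t: "t \<in> Q" "t \<notin> C \<union> S" for t
  proof -
    have "subj t \<in> fst ` P" using D(8) t by auto
    then obtain M where M: "(subj t, M) \<in> P" by force
    then have "(subj t, star Q (subj t)) \<in> P" using D(6)[OF M] by simp
    moreover have "t \<in> star Q (subj t)" using t by (simp add: star_def)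
    \<comment> \<open>The uncovered \<open>t\<close> keeps its subject's star from being contained
      in \<open>C \<union> S\<close>. That star is therefore not discarded as covered, and it
      differs from the selected one, which is covered.\<close>
    ultimately have "(subj t, star Q (subj t)) \<in> ?P"
      using t S(3) unfolding remaining_def by auto
    then show ?thesis by force
  qed
  moreover have "S \<subseteq> Q" using S(2) by (auto simp: star_def)
  moreover have "M = star Q m \<and> (\<exists>t\<in>Q. subj t = m)" if "(m, M) \<in> ?P" for m M
    using that sub D(6,7) by blast
  ultimately show ?thesis
    using R'(1,2) D(4) finite_subset[OF sub D(2)] unfolding mdr_invariant_def by auto
qed

lemma mdr_invariant_step:
  assumes "mdr_step V \<sigma> \<sigma>'" "is_query V Q" "mdr_invariant V Q \<sigma>"
  shows "mdr_invariant V Q \<sigma>'"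
  using assms
proof (induction rule: mdr_step.induct)
  case (plain C P n Q' S' T S R)
  note D = mdr_invariantD[OF plain.prems(2)]
  have n: "(n, Q') \<in> P" using plain by (simp add: max_uncovered_def)
  then have Q': "Q' = star Q n" using D(6) by blast
  show ?case unfolding Q'
  proof (rule mdr_invariant_select[OF plain.prems(2)])
    show "\<Union>(insert S R) = C \<union> S" using D(3) by auto
    show "so_query_center V n S" using plain by simp
    show "S \<subseteq> star Q n" using plain.hyps Q' by (auto simp: inner_part_def)
    \<comment> \<open>Only triples already in \<open>C\<close> are left out of the star.\<close>
    show "star Q n \<subseteq> C \<union> S"
      using plain.hyps Q' by (auto simp: inner_part_def removable_part_def)
  qed (use n Q' D(1,5) in auto)
next
  case (reshape C P n Q' S' T t' F R S)
  note D = mdr_invariantD[OF reshape.prems(2)]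
  have n: "(n, Q') \<in> P" using reshape by (simp add: max_uncovered_def)
  then have Q': "Q' = star Q n" using D(6) by blast
  have t': "t' \<in> star Q n" "subj t' = n"
    using reshape.hyps Q' by (auto simp: removable_part_def)
  obtain c where c: "so_query_center V c F" "c \<notin> fst ` P" using D(5) reshape.hyps by blast
  have "n \<noteq> c" using n c(2) by force
  then have F: "so_query_center V c (F - {t'})"
    using so_query_center_Diff_incoming c(1) t'(2) by metis
  have sub: "S \<subseteq> star Q n" using reshape.hyps Q' t'(1) by (auto simp: inner_part_def)
  show ?case unfolding Q'
  proof (rule mdr_invariant_select[OF reshape.prems(2)])
    \<comment> \<open>The triple taken from \<open>F\<close> reappears in \<open>S\<close>, so
      coverage is kept.\<close>
    show "\<Union>(insert S (insert (F - {t'}) (R - {F}))) = C \<union> S"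
      using D(3) reshape.hyps(6,8) by auto
    show "so_query_center V n S"
      using so_query_center_subset_star[OF reshape.prems(1) sub] t'(2) reshape.hyps(8) by blast
    show "star Q n \<subseteq> C \<union> S"
      using reshape.hyps(2,3,8) Q' by (auto simp: inner_part_def removable_part_def)
    show "G = S \<or> (\<exists>c. so_query_center V c G \<and> c \<notin> fst ` P)"
      if "G \<in> insert S (insert (F - {t'}) (R - {F}))" for G
      using that D(5) F c(2) by blast
  qed (use n Q' D(1) sub in auto)
qed

lemma mdr_invariant_reachable:
  assumes "(mdr_step V)\<^sup>*\<^sup>* (mdr_init V Q) \<sigma>" "vocabulary_ok V" "is_query V Q"
  shows "mdr_invariant V Q \<sigma>"
  using assms(1)
proof (induction rule: rtranclp_induct)
  case base
  show ?case using mdr_invariant_init assms(2,3) .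
next
  case (step \<sigma> \<sigma>')
  then show ?case using mdr_invariant_step assms(3) by blast
qed

text \<open>A pair can always be selected; what needs proof is that a failing plain case leaves a
  removable triple lying in some query of \<open>R\<close>.\<close>

lemma mdr_step_exists:
  assumes q: "is_query V Q" and inv: "mdr_invariant V Q (R, C, P)" and P: "P \<noteq> {}"
  shows "\<exists>\<sigma>. mdr_step V (R, C, P) \<sigma>"
proof -
  note D = mdr_invariantD[OF inv]
  obtain n Q' where max: "max_uncovered C P n Q'" using ex_max_uncovered[OF D(2) P] by blast
  then have n: "(n, Q') \<in> P" by (simp add: max_uncovered_def)
  then have Q': "Q' = star Q n" using D(6) by blast
  let ?I = "inner_part V C n Q'" and ?T = "removable_part V C n Q'"
  show ?thesis
  proof (cases "so_query_center V n (?I - ?T)")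
    case True
    show ?thesis using mdr_step.plain[OF max refl refl True refl] by blast
  next
    case False
    obtain t where t: "t \<in> Q" "subj t = n" using D(7) n by blast
    have "?I - ?T \<subseteq> star Q n" using Q' by (auto simp: inner_part_def)
    \<comment> \<open>Otherwise \<open>t\<close>, with subject \<open>n\<close>, would make
      \<open>?I - ?T\<close> a star query centered at \<open>n\<close>.\<close>
    then have "t \<notin> ?I - ?T" using so_query_center_subset_star[OF q] t(2) False by blast
    moreover have tQ': "t \<in> Q'" using t Q' by (simp add: star_def)
    ultimately have tC: "t \<in> C" by (auto simp: inner_part_def removable_part_def)
    then obtain F where F: "F \<in> R" "t \<in> F" using D(3) by blast
    then obtain c where c: "so_query_center V c F" "c \<notin> fst ` P" using D(5) by blast
    have "c \<noteq> n" using n c(2) by force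
    \<comment> \<open>In \<open>F\<close> the triple \<open>t\<close> touches \<open>c\<close>; its
      subject is \<open>n\<close>, so its object must be \<open>c\<close>. Hence the removal of
      incoming triples in \<open>inner_part\<close> does not affect \<open>t\<close>, and only
      \<open>?T\<close> can have taken it out.\<close>
    then have "obj t \<noteq> n" using c(1) F(2) t(2) unfolding so_query_center_def by metis
    then have "t \<in> ?I" using tQ' by (simp add: inner_part_def)
    then have "t \<in> ?T" using \<open>t \<notin> ?I - ?T\<close> by blast
    then show ?thesis using mdr_step.reshape[OF max refl refl False _ F refl] by blast
  qed
qed

lemma mdr_step_pending_psubset:
  assumes "mdr_step V (R, C, P) (R', C', P')"
  shows "P' \<subset> P"
proof -
  obtain n Q' where "(n, Q') \<in> P" "P' = remaining C' P (n, Q')"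
    using assms by cases (auto simp: max_uncovered_def)
  then show ?thesis using remaining_subset[of C' P "(n, Q')"] by blast
qed

lemma termip_mdr_step:
  assumes "finite P"
  shows "termip (mdr_step V) (R, C, P)"
  using assms
proof (induction P arbitrary: R C rule: finite_psubset_induct)
  case (psubset P)
  show ?case
  proof (rule accp.accI)
    \<comment> \<open>\<open>termip\<close> is accessibility for the converse relation, so the
      predecessors to consider are the successor states of the loop.\<close>
    fix \<sigma> assume step: "(mdr_step V)\<inverse>\<inverse> \<sigma> (R, C, P)"
    obtain R' C' P' where \<sigma>: "\<sigma> = (R', C', P')" by (cases \<sigma>)
    then have "P' \<subset> P" using step mdr_step_pending_psubset by (metis conversepD)
    then show "termip (mdr_step V) \<sigma>" unfolding \<sigma> by (rule psubset.IH)
  qed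
qed

text \<open>An uncovered triple would need a pending subject, so all of \<open>Q\<close> is covered;
  the members of \<open>R\<close> are non-empty because they are star queries.\<close>

lemma mdr_invariant_final:
  assumes "mdr_invariant V Q (R, C, {})"
  shows "is_decomposition Q R" "\<forall>F\<in>R. so_query V F"
proof -
  note D = mdr_invariantD[OF assms]
  have "C = Q" using D(4,8) by auto
  then show "is_decomposition Q R"
    using D(1,3,5) unfolding is_decomposition_def so_query_center_def by blast
  show "\<forall>F\<in>R. so_query V F" using D(5) unfolding so_query_def by blast
qed

theorem proposition15:
  fixes V :: "'a vocabulary" and Q :: "'a triple set"
  assumes "vocabulary_ok V" and "is_query V Q"
  shows "mdr_always_returns V Q \<and>
    (\<forall>R. mdr_output V Q R \<longrightarrow> is_decomposition Q R \<and> (\<forall>F\<in>R. so_query V F))"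
proof (intro conjI allI impI)
  obtain R C P where init: "mdr_init V Q = (R, C, P)" by (cases "mdr_init V Q")
  then have "finite P" using mdr_invariantD(2) mdr_invariant_init[OF assms] by metis
  then show "mdr_always_returns V Q"
    unfolding mdr_always_returns_def
    using termip_mdr_step init mdr_step_exists[OF assms(2)]
      mdr_invariant_reachable[OF _ assms] by metis
next
  fix R assume "mdr_output V Q R"
  then obtain C where "mdr_invariant V Q (R, C, {})"
    using mdr_invariant_reachable[OF _ assms] unfolding mdr_output_def by blast
  then show "is_decomposition Q R" "\<forall>F\<in>R. so_query V F"
    by (rule mdr_invariant_final)+
qed

end
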